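(* Let $V, Y, Q, \Lambda, \Lambda_\circ, f, u, c_1, c_2$ and $\|\cdot\|_\circ$ be as in the context, and put $$\rho_*:=\frac{c_1}{c_2^2},\qquad q_*:=\Bigl(1-\frac{c_1^2}{c_2^2}\Bigr)^{1/2}\in[0,1).$$ Then for any $u_0\in V$ and $\rho=\rho_*$, the sequence $\{u_k\}_{k\ge 0}\subset V$ of functions satisfying, for every $k\ge 1$, the relation $$(\Lambda_\circ Q u_k, Qw)=(\Lambda_\circ Qu_{k-1}, Qw) - \rho \Bigl( (\Lambda Q u_{k-1}, Qw)-\langle f,w\rangle\Bigr) \qquad \forall w\in V$$ converges to $u$ in $V$, and $$\|u_k-u\|_\circ\le q_*^k\,\|u_0-u\|_\circ\qquad\text{for all } k\ge 0.$$
   Context: Setting. $V$ is a (real) reflexive Banach space with norm $\|\cdot\|_V$, $V^*$ is its dual, and $\langle v^*,v\rangle$ is the duality pairing. $Y$ is a (real) Hilbert space with scalar product $(\cdot,\cdot)$ and norm $\|\cdot\|$. $Q:V\to Y$ is a bounded linear operator with conjugate $Q^*:Y\to V^*$, i.e. $(y,Qw)=\langle Q^*y,w\rangle$ for all $y\in Y$, $w\in V$, and there is a constant $c>0$ such that $\|Qw\|\ge c\|w\|_V$ for all $w\in V$. $f\in\mathcal V$, where $\mathcal V$ is a Hilbert space intermediate between $V$ and $V^*$ ($V\subset\mathcal V\subset V^*$); in particular $f$ is regarded as an element of $V^*$. $\Lambda,\Lambda_\circ:Y\to Y$ are bounded linear self-adjoint operators for which there are constants $0<\lambda^\circ_\ominus\le\lambda^\circ_\oplus$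 and $0<\lambda_\ominus<\lambda_\oplus$ with $$\lambda^\circ_\ominus\|y\|^2\le(\Lambda_\circ y,y)\le\lambda^\circ_\oplus\|y\|^2,\qquad \lambda_\ominus\|y\|^2\le(\Lambda y,y)\le\lambda_\oplus\|y\|^2\qquad\forall y\in Y.$$ $c_1$ and $c_2$ are the minimal and maximal (generalized) eigenvalues of $\Lambda y-\mu\Lambda_\circ y=0$, i.e. the best constants (infimum and supremum over $y\neq0$ of $(\Lambda y,y)/(\Lambda_\circ y,y)$) in $$c_1(\Lambda_\circ y,y)\le(\Lambda y,y)\le c_2(\Lambda_\circ y,y)\qquad\forall y\in Y.$$ For $w\in V$, $\|w\|_\circ:=(\Lambda_\circ Qw,Qw)^{1/2}$. The function $u\in V$ is the (unique) solution of $$(\Lambda Qu,Qw)=\langle f,w\rangle\qquad\forall w\in V.$$ *)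

theory Defs
  imports "HOL-Analysis.Analysis"
begin

text \<open>The dual of a real normed space \<open>'v\<close> is the type \<open>'v \<Rightarrow>\<^sub>L real\<close>, and the duality pairing is
  the application of a functional. A real Hilbert space is a type of sort
  \<open>{real_inner, complete_space}\<close>.\<close>

definition reflexive_space :: "'v::real_normed_vector itself \<Rightarrow> bool" where
  "reflexive_space _ \<longleftrightarrow>
     (\<forall>\<phi> :: ('v \<Rightarrow>\<^sub>L real) \<Rightarrow>\<^sub>L real. \<exists>v::'v. \<forall>g :: 'v \<Rightarrow>\<^sub>L real. blinfun_apply \<phi> g = blinfun_apply g v)"

definition self_adjoint :: "('y::real_inner \<Rightarrow>\<^sub>L 'y) \<Rightarrow> bool" where
  "self_adjoint A \<longleftrightarrow> (\<forall>x y. inner (A x) y = inner x (A y))"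

text \<open>The extreme generalized eigenvalues of \<open>A y - \<mu> B y = 0\<close>. On an infinite-dimensional space the
  bounds need not be attained, so they are the infimum and supremum of the Rayleigh quotient; these
  are meaningful only if the space is nontrivial.\<close>

definition min_gen_eigenvalue :: "('y::real_inner \<Rightarrow>\<^sub>L 'y) \<Rightarrow> ('y \<Rightarrow>\<^sub>L 'y) \<Rightarrow> real" where
  "min_gen_eigenvalue A B = (INF y\<in>{y. y \<noteq> 0}. inner (A y) y / inner (B y) y)"

definition max_gen_eigenvalue :: "('y::real_inner \<Rightarrow>\<^sub>L 'y) \<Rightarrow> ('y \<Rightarrow>\<^sub>L 'y) \<Rightarrow> real" where
  "max_gen_eigenvalue A B = (SUP y\<in>{y. y \<noteq> 0}. inner (A y) y / inner (B y) y)"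

definition energy_norm ::
  "('y::real_inner \<Rightarrow>\<^sub>L 'y) \<Rightarrow> ('v::real_normed_vector \<Rightarrow>\<^sub>L 'y) \<Rightarrow> 'v \<Rightarrow> real" where
  "energy_norm B Q w = sqrt (inner (B (Q w)) (Q w))"

text \<open>\<open>V \<subset> H \<subset> V\<^sup>*\<close> as bounded linear injections.\<close>

definition intermediate_space ::
  "('v::real_normed_vector \<Rightarrow>\<^sub>L 'h::real_normed_vector) \<Rightarrow> ('h \<Rightarrow>\<^sub>L ('v \<Rightarrow>\<^sub>L real)) \<Rightarrow> bool" where
  "intermediate_space i j \<longleftrightarrow> inj (blinfun_apply i) \<and> inj (blinfun_apply j)"

text \<open>\<open>us\<close> is the sequence of iterates with step \<open>\<rho>\<close> started at \<open>u0\<close>; \<open>F\<close> is the right-hand side as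
  an element of the dual.\<close>

definition iterates ::
  "('y::real_inner \<Rightarrow>\<^sub>L 'y) \<Rightarrow> ('y \<Rightarrow>\<^sub>L 'y) \<Rightarrow> ('v::real_normed_vector \<Rightarrow>\<^sub>L 'y) \<Rightarrow> ('v \<Rightarrow>\<^sub>L real)
     \<Rightarrow> real \<Rightarrow> 'v \<Rightarrow> (nat \<Rightarrow> 'v) \<Rightarrow> bool" where
  "iterates A B Q F \<rho> u0 us \<longleftrightarrow> us 0 = u0 \<and>
     (\<forall>k\<ge>1. \<forall>w. inner (B (Q (us k))) (Q w) =
        inner (B (Q (us (k - 1)))) (Q w) - \<rho> * (inner (A (Q (us (k - 1)))) (Q w) - F w))"

end

theory Submission
  imports Defs
begin

text \<open>With \<open>e\<close> and \<open>e'\<close> two consecutive errors and \<open>d = e' - e\<close>, the scheme says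
  \<open>a\<^sub>0 d w = - \<rho> a e w\<close> for the forms \<open>a\<^sub>0\<close>, \<open>a\<close> induced on \<open>V\<close> by \<open>A\<^sub>0\<close>, \<open>A\<close>. Testing with \<open>e\<close> and \<open>d\<close>
  gives \<open>a\<^sub>0 e' e' = a\<^sub>0 e e - 2 \<rho> a e e + a\<^sub>0 d d\<close> and \<open>a\<^sub>0 d d \<le> \<rho>\<^sup>2 c\<^sub>2 a e e\<close>, so that the choice
  \<open>\<rho> = c\<^sub>1 / c\<^sub>2\<^sup>2\<close> together with \<open>c\<^sub>1 a\<^sub>0 e e \<le> a e e\<close> makes one step a contraction by \<open>q\<close>. Solvability of
  each step is the symmetric Lax--Milgram theorem, obtained by minimizing the quadratic energy.\<close>

text \<open>Symmetry makes \<open>2 * (a v w - L w)\<close> the derivative at \<open>v\<close> in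
  direction \<open>w\<close> of \<open>J v = a v v - 2 * L v\<close>, so a minimizer of
  \<open>J\<close> solves the equation. Coercivity bounds \<open>J\<close> from below and makes
  minimizing sequences Cauchy; completeness supplies the minimizer.\<close>

lemma symmetric_Lax_Milgram:
  fixes a :: "'v::banach \<Rightarrow> 'v \<Rightarrow> real"
  assumes bil: "bounded_bilinear a" and sym: "\<And>x y. a x y = a y x"
    and pos: "\<alpha> > 0" and coer: "\<And>x. \<alpha> * (norm x)\<^sup>2 \<le> a x x"
    and lin: "bounded_linear L"
  shows "\<exists>v. \<forall>w. a v w = L w"
proof -
  interpret bounded_bilinear a by (fact bil)
  interpret L: bounded_linear L by (fact lin)
  define J where "J v = a v v - 2 * L v" for v
  obtain K where K: "\<And>x. norm (L x) \<le> norm x * K"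
    using L.bounded by blast
  \<comment> \<open>Coercivity and the bound \<open>K\<close> on \<open>L\<close> leave a quadratic
    in \<open>norm v\<close>; complete the square.\<close>
  have below: "- (K\<^sup>2 / \<alpha>) \<le> J v" for v
  proof -
    have "0 \<le> (\<alpha> * norm v - K)\<^sup>2 / \<alpha>"
      using pos by simp
    also have "\<dots> = \<alpha> * (norm v)\<^sup>2 - 2 * (norm v * K) + K\<^sup>2 / \<alpha>"
      using pos by (simp add: field_simps power2_eq_square)
    also have "\<dots> \<le> J v + K\<^sup>2 / \<alpha>"
      using coer[of v] K[of v] unfolding J_def by (simp add: abs_le_iff)
    finally show ?thesis by simp
  qed
  define m where "m = (INF v. J v)"
  have bdd: "bdd_below (range J)"
    using below by (meson bdd_belowI2)
  have m_le: "m \<le> J v" for v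
    unfolding m_def by (rule cINF_lower[OF bdd]) simp
  have "\<exists>v. J v < m + inverse (real (Suc n))" for n
  proof -
    have "(INF v. J v) < m + inverse (real (Suc n))"
      unfolding m_def[symmetric] by simp
    then show ?thesis
      using cINF_less_iff[OF _ bdd] by auto
  qed
  then obtain X where X: "\<And>n. J (X n) < m + inverse (real (Suc n))"
    by metis
  \<comment> \<open>Parallelogram identity for \<open>a\<close>; the linear parts of the three
    \<open>J\<close> terms cancel.\<close>
  have par: "a (x - y) (x - y) = 2 * J x + 2 * J y - 4 * J ((1/2) *\<^sub>R (x + y))" for x y
    unfolding J_def by (simp add: add_left add_right diff_left diff_right scaleR_left scaleR_right
        L.add L.scaleR sym[of y x] algebra_simps)
  \<comment> \<open>The midpoint has energy at least \<open>m\<close>, while \<open>X k\<close> and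
    \<open>X l\<close> exceed \<open>m\<close> by less than their tolerances, so \<open>m\<close>
    drops out of the identity.\<close>
  have dist: "\<alpha> * (norm (X k - X l))\<^sup>2 \<le> 2 * inverse (real (Suc k)) + 2 * inverse (real (Suc l))" for k l
    using coer[of "X k - X l"] par[of "X k" "X l"] X[of k] X[of l] m_le[of "(1/2) *\<^sub>R (X k + X l)"]
    by linarith
  have "Cauchy X"
  proof (rule CauchyI)
    fix e :: real assume "e > 0"
    \<comment> \<open>The factor 4 absorbs the two tolerances, each counted twice in
      \<open>dist\<close>.\<close>
    then have "\<alpha> * e\<^sup>2 / 4 > 0" using pos by simp
    then obtain M where M: "inverse (real (Suc M)) < \<alpha> * e\<^sup>2 / 4"
      using reals_Archimedean by blast
    have "norm (X k - X l) < e" if "k \<ge> M" "l \<ge> M" for k l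
    proof -
      have "inverse (real (Suc k)) \<le> inverse (real (Suc M))" "inverse (real (Suc l)) \<le> inverse (real (Suc M))"
        using that by (auto intro!: le_imp_inverse_le)
      then have "\<alpha> * (norm (X k - X l))\<^sup>2 < \<alpha> * e\<^sup>2"
        using dist[of k l] M by linarith
      then have "(norm (X k - X l))\<^sup>2 < e\<^sup>2" using pos by simp
      then show ?thesis using \<open>e > 0\<close> by (simp add: power2_less_imp_less)
    qed
    then show "\<exists>M. \<forall>k\<ge>M. \<forall>l\<ge>M. norm (X k - X l) < e" by blast
  qed
  then obtain v where v: "X \<longlonglongrightarrow> v"
    using Cauchy_convergent convergent_def by blast
  have "(\<lambda>n. J (X n)) \<longlonglongrightarrow> J v"
    unfolding J_def by (intro tendsto_intros tendsto[OF v v] L.tendsto[OF v])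
  moreover have "(\<lambda>n. m + inverse (real (Suc n))) \<longlonglongrightarrow> m"
    using tendsto_add[OF tendsto_const LIMSEQ_inverse_real_of_nat] by simp
  ultimately have "J v \<le> m"
    by (rule LIMSEQ_le) (use X less_imp_le in blast)
  then have min: "J v \<le> J w" for w
    using m_le order_trans by blast
  have "a v w = L w" for w
  proof (cases "w = 0")
    case True
    then show ?thesis by (simp add: zero_right L.zero)
  next
    case False
    define p where "p = a w w"
    define r where "r = a v w - L w"
    have "p > 0"
      using coer[of w] pos False unfolding p_def
      by (smt (verit) mult_pos_pos zero_less_norm_iff zero_less_power)
    \<comment> \<open>The minimizer of \<open>t\<^sup>2 * p + 2 * t * r\<close>, the change of
      energy along \<open>w\<close>. Its value \<open>- (r\<^sup>2 / p)\<close> cannot be negative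
      at a minimizer of \<open>J\<close>, hence \<open>r = 0\<close>.\<close>
    define t where "t = - (r / p)"
    have "J (v + t *\<^sub>R w) = J v + (t\<^sup>2 * p + 2 * t * r)"
      unfolding J_def p_def r_def
      by (simp add: add_left add_right scaleR_left scaleR_right L.add L.scaleR sym[of w v]
          algebra_simps power2_eq_square)
    also have "t\<^sup>2 * p + 2 * t * r = - (r\<^sup>2 / p)"
      using \<open>p > 0\<close> unfolding t_def by (simp add: field_simps power2_eq_square)
    finally have "r\<^sup>2 / p \<le> 0"
      using min[of "v + t *\<^sub>R w"] by linarith
    then have "r = 0"
      using \<open>p > 0\<close> by (simp add: divide_le_0_iff)
    then show ?thesis unfolding r_def by simp
  qed
  then show ?thesis by blast
qed

text \<open>The ellipticity constants confine the Rayleigh quotient to the interval from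
  \<open>lmin / lmax0\<close> to \<open>lmax / lmin0\<close>. Its infimum and supremum are thus
  taken over a nonempty bounded set, so they are genuine bounds, and the infimum is
  positive.\<close>

lemma gen_eigenvalue_bounds:
  fixes A B :: "'y::real_inner \<Rightarrow>\<^sub>L 'y"
  assumes nontriv: "\<exists>y::'y. y \<noteq> 0"
    and pos: "0 < lmin0" "0 < lmin"
    and B: "\<And>y. lmin0 * (norm y)\<^sup>2 \<le> inner (B y) y" "\<And>y. inner (B y) y \<le> lmax0 * (norm y)\<^sup>2"
    and A: "\<And>y. lmin * (norm y)\<^sup>2 \<le> inner (A y) y" "\<And>y. inner (A y) y \<le> lmax * (norm y)\<^sup>2"
  shows "0 < min_gen_eigenvalue A B" "min_gen_eigenvalue A B \<le> max_gen_eigenvalue A B"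
    and "min_gen_eigenvalue A B * inner (B y) y \<le> inner (A y) y"
    and "inner (A y) y \<le> max_gen_eigenvalue A B * inner (B y) y"
proof -
  let ?R = "\<lambda>y. inner (A y) y / inner (B y) y"
  have Bpos: "0 < inner (B y) y" if "y \<noteq> 0" for y
    using B(1)[of y] pos that by (smt (verit) mult_pos_pos zero_less_norm_iff zero_less_power)
  have Apos: "0 < inner (A y) y" if "y \<noteq> 0" for y
    using A(1)[of y] pos that by (smt (verit) mult_pos_pos zero_less_norm_iff zero_less_power)
  \<comment> \<open>Both forms are positive at \<open>z\<close>, which forces \<open>lmax0\<close>
    and \<open>lmax\<close> to be positive; \<open>z\<close> also makes the index set of the infimum
    nonempty.\<close>
  obtain z :: 'y where z: "z \<noteq> 0" using nontriv by blast
  have lmax0: "0 < lmax0"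
    using Bpos[OF z] B(2)[of z] by (smt (verit) mult_nonpos_nonneg zero_le_power2)
  have lmax: "0 < lmax"
    using Apos[OF z] A(2)[of z] by (smt (verit) mult_nonpos_nonneg zero_le_power2)
  have lower: "lmin / lmax0 \<le> ?R y" if "y \<noteq> 0" for y
  proof -
    have "lmin * inner (B y) y \<le> lmin * (lmax0 * (norm y)\<^sup>2)"
      using B(2)[of y] pos by simp
    also have "\<dots> \<le> inner (A y) y * lmax0"
      using mult_right_mono[OF A(1)[of y], of lmax0] lmax0 by (simp add: mult_ac)
    finally show ?thesis
      using Bpos[OF that] lmax0 by (simp add: field_simps)
  qed
  have upper: "?R y \<le> lmax / lmin0" if "y \<noteq> 0" for y
  proof -
    have "inner (A y) y * lmin0 \<le> lmax * (norm y)\<^sup>2 * lmin0"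
      using A(2)[of y] pos by simp
    also have "\<dots> \<le> lmax * inner (B y) y"
      using mult_left_mono[OF B(1)[of y], of lmax] lmax by (simp add: mult_ac)
    finally show ?thesis
      using Bpos[OF that] pos by (simp add: field_simps)
  qed
  have bdd: "bdd_below (?R ` {y. y \<noteq> 0})" "bdd_above (?R ` {y. y \<noteq> 0})"
    by (rule bdd_belowI2, use lower in blast) (rule bdd_aboveI2, use upper in blast)
  have le: "min_gen_eigenvalue A B \<le> ?R y" "?R y \<le> max_gen_eigenvalue A B" if "y \<noteq> 0" for y
    unfolding min_gen_eigenvalue_def max_gen_eigenvalue_def
    using that by (auto intro: cINF_lower cSUP_upper bdd)
  have "lmin / lmax0 \<le> min_gen_eigenvalue A B"
    unfolding min_gen_eigenvalue_def by (rule cINF_greatest) (use z lower in auto)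
  then show "0 < min_gen_eigenvalue A B"
    using pos lmax0 by (smt (verit) divide_pos_pos)
  show "min_gen_eigenvalue A B \<le> max_gen_eigenvalue A B"
    using le[OF z] by linarith
  show "min_gen_eigenvalue A B * inner (B y) y \<le> inner (A y) y"
    using le(1)[of y] Bpos[of y] by (cases "y = 0") (auto simp: field_simps)
  show "inner (A y) y \<le> max_gen_eigenvalue A B * inner (B y) y"
    using le(2)[of y] Bpos[of y] by (cases "y = 0") (auto simp: field_simps)
qed

lemma one_step_contraction:
  fixes a a0 :: "'v::real_normed_vector \<Rightarrow> 'v \<Rightarrow> real"
  assumes bil: "bounded_bilinear a" "bounded_bilinear a0"
    and sym: "\<And>x y. a x y = a y x" "\<And>x y. a0 x y = a0 y x"
    and nonneg: "\<And>x. 0 \<le> a x x" "\<And>x. 0 \<le> a0 x x"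
    and c: "0 < c1" "c1 \<le> c2" "\<And>x. c1 * a0 x x \<le> a x x" "\<And>x. a x x \<le> c2 * a0 x x"
    and step: "\<And>w. a0 e' w = a0 e w - c1 / c2\<^sup>2 * a e w"
  shows "a0 e' e' \<le> (1 - c1\<^sup>2 / c2\<^sup>2) * a0 e e"
proof -
  interpret a: bounded_bilinear a by (fact bil)
  interpret a0: bounded_bilinear a0 by (fact bil)
  define \<rho> where "\<rho> = c1 / c2\<^sup>2"
  have c2: "c2 > 0" and \<rho>: "\<rho> > 0" using c unfolding \<rho>_def by simp_all
  define d where "d = e' - e"
  have d: "a0 d w = - \<rho> * a e w" for w
    using step[of w] unfolding d_def \<rho>_def by (simp add: a0.diff_left)
  have e': "e' = e + d" unfolding d_def by simp
  have "a0 e' e' = a0 e e + 2 * a0 d e + a0 d d"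
    unfolding e' by (simp add: a0.add_left a0.add_right sym(2)[of e d])
  then have expand: "a0 e' e' = a0 e e - 2 * \<rho> * a e e + a0 d d"
    using d[of e] by simp
  \<comment> \<open>The bound on \<open>a0 d d\<close> is Cauchy-Schwarz for \<open>a\<close>: the
    square of \<open>a e d\<close> is at most \<open>a e e * a d d\<close>, hence at most
    \<open>c2 * a e e * a0 d d\<close>. Deriving it from nonnegativity of \<open>a\<close> at
    \<open>e + t *\<^sub>R d\<close> avoids dividing by \<open>a0 d d\<close>, which may
    vanish.\<close>
  have aed: "a e d = - (a0 d d / \<rho>)"
    using d[of d] \<rho> by (simp add: field_simps)
  define t where "t = 1 / (\<rho> * c2)"
  \<comment> \<open>This \<open>t\<close> minimizes the upper bound \<open>a e e + 2 t a e d + t\<^sup>2 c\<^sub>2 a\<^sub>0 d d\<close> of \<open>a (e + t d) (e + t d)\<close>.\<close>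
  have "0 \<le> a (e + t *\<^sub>R d) (e + t *\<^sub>R d)" by (rule nonneg)
  also have "\<dots> = a e e + 2 * t * a e d + t\<^sup>2 * a d d"
    by (simp add: a.add_left a.add_right a.scaleR_left a.scaleR_right sym(1)[of d e]
        power2_eq_square algebra_simps)
  also have "\<dots> \<le> a e e + 2 * t * a e d + t\<^sup>2 * (c2 * a0 d d)"
    using c(4)[of d] by (simp add: mult_left_mono)
  also have "\<dots> = a e e - a0 d d / (\<rho>\<^sup>2 * c2)"
    unfolding aed t_def using \<rho> c2 by (simp add: field_simps power2_eq_square)
  finally have "a0 d d \<le> \<rho>\<^sup>2 * c2 * a e e"
    using \<rho> c2 by (simp add: field_simps)
  then have *: "a0 e' e' \<le> a0 e e - (2 * \<rho> - \<rho>\<^sup>2 * c2) * a e e"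
    unfolding expand by (simp add: algebra_simps)
  \<comment> \<open>Here \<open>\<rho> * c2 = c1 / c2\<close>. Hence the decrease is at least
    \<open>\<rho> * a e e\<close>, and \<open>\<rho> * c1\<close> is exactly
    \<open>c1\<^sup>2 / c2\<^sup>2\<close>.\<close>
  have "\<rho> * c2 \<le> 1"
    unfolding \<rho>_def using c c2 by (simp add: field_simps power2_eq_square)
  then have "\<rho> * (\<rho> * c2) \<le> \<rho> * 1"
    using \<rho> by (intro mult_left_mono) auto
  then have "\<rho> \<le> 2 * \<rho> - \<rho>\<^sup>2 * c2"
    by (simp add: power2_eq_square)
  then have "\<rho> * a e e \<le> (2 * \<rho> - \<rho>\<^sup>2 * c2) * a e e"
    using nonneg(1) by (rule mult_right_mono)
  moreover have "\<rho> * (c1 * a0 e e) \<le> \<rho> * a e e"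
    using c(3)[of e] \<rho> by simp
  moreover have "\<rho> * (c1 * a0 e e) = c1\<^sup>2 / c2\<^sup>2 * a0 e e"
    unfolding \<rho>_def by (simp add: power2_eq_square)
  ultimately show ?thesis
    using * by (simp add: algebra_simps)
qed

text \<open>The unique existence of the iterates ensures that the claim about every such sequence is
  not vacuous.\<close>

theorem theorem2p1:
  fixes Q :: "'v::banach \<Rightarrow>\<^sub>L 'y::{real_inner,complete_space}"
    and Qs :: "'y \<Rightarrow>\<^sub>L ('v \<Rightarrow>\<^sub>L real)"
    and A A\<^sub>0 :: "'y \<Rightarrow>\<^sub>L 'y"
    and i :: "'v \<Rightarrow>\<^sub>L 'h::{real_inner,complete_space}"
    and j :: "'h \<Rightarrow>\<^sub>L ('v \<Rightarrow>\<^sub>L real)"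
    and f :: 'h
    and u u\<^sub>0 :: 'v
    and c lmin0 lmax0 lmin lmax c\<^sub>1 c\<^sub>2 \<rho> q :: real
  assumes "reflexive_space TYPE('v)"
    and "\<exists>y::'y. y \<noteq> 0"
    and "\<forall>y w. inner y (Q w) = Qs y w"
    and "c > 0" and "\<forall>w. norm (Q w) \<ge> c * norm w"
    and "intermediate_space i j"
    and "self_adjoint A" and "self_adjoint A\<^sub>0"
    and "0 < lmin0" and "lmin0 \<le> lmax0"
    and "0 < lmin" and "lmin < lmax"
    and "\<forall>y. lmin0 * (norm y)\<^sup>2 \<le> inner (A\<^sub>0 y) y \<and> inner (A\<^sub>0 y) y \<le> lmax0 * (norm y)\<^sup>2"
    and "\<forall>y. lmin * (norm y)\<^sup>2 \<le> inner (A y) y \<and> inner (A y) y \<le> lmax * (norm y)\<^sup>2"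
    and "c\<^sub>1 = min_gen_eigenvalue A A\<^sub>0" and "c\<^sub>2 = max_gen_eigenvalue A A\<^sub>0"
    and "\<forall>w. inner (A (Q u)) (Q w) = j f w"
    and "\<rho> = c\<^sub>1 / c\<^sub>2\<^sup>2" and "q = sqrt (1 - c\<^sub>1\<^sup>2 / c\<^sub>2\<^sup>2)"
  shows "0 \<le> q \<and> q < 1 \<and>
    (\<exists>!us. iterates A A\<^sub>0 Q (j f) \<rho> u\<^sub>0 us) \<and>
    (\<forall>us. iterates A A\<^sub>0 Q (j f) \<rho> u\<^sub>0 us \<longrightarrow>
       us \<longlonglongrightarrow> u \<and>
       (\<forall>k. energy_norm A\<^sub>0 Q (us k - u) \<le> q ^ k * energy_norm A\<^sub>0 Q (u\<^sub>0 - u)))"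
proof -
  define a where "a x y = inner (A (Q x)) (Q y)" for x y
  define a0 where "a0 x y = inner (A\<^sub>0 (Q x)) (Q y)" for x y
  have AQ: "bounded_linear (\<lambda>x. blinfun_apply B (Q x))" for B :: "'y \<Rightarrow>\<^sub>L 'y"
    by (intro bounded_linear_compose[OF blinfun.bounded_linear_right] blinfun.bounded_linear_right)
  have bil: "bounded_bilinear a" "bounded_bilinear a0"
    unfolding a_def a0_def
    by (rule bounded_bilinear.comp[OF bounded_bilinear_inner AQ blinfun.bounded_linear_right])+
  interpret a: bounded_bilinear a by (fact bil)
  interpret a0: bounded_bilinear a0 by (fact bil)
  have sym: "a x y = a y x" "a0 x y = a0 y x" for x y
    using assms(7,8) unfolding a_def a0_def self_adjoint_def by (metis inner_commute)+
  note eig = gen_eigenvalue_bounds[of lmin0 lmin A\<^sub>0 lmax0 A lmax, folded assms(15,16)]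
  have c1: "0 < c\<^sub>1" and c12: "c\<^sub>1 \<le> c\<^sub>2"
    by (rule eig; use assms in blast)+
  have cb: "c\<^sub>1 * a0 x x \<le> a x x" "a x x \<le> c\<^sub>2 * a0 x x" for x
    unfolding a_def a0_def by (rule eig; use assms in blast)+
  \<comment> \<open>The coercivity constant of \<open>a0\<close> on the domain of \<open>Q\<close>:
    \<open>lmin0\<close> comes from \<open>A\<^sub>0\<close> and \<open>c\<close> from the lower
    bound on \<open>Q\<close>. It yields solvability and uniqueness of each step, and the passage
    from the energy norm to the norm of the space.\<close>
  define \<alpha> where "\<alpha> = lmin0 * c\<^sup>2"
  have \<alpha>: "\<alpha> > 0" using assms(4,9) unfolding \<alpha>_def by simp
  have coer: "\<alpha> * (norm x)\<^sup>2 \<le> a0 x x" for x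
  proof -
    have "(c * norm x)\<^sup>2 \<le> (norm (Q x))\<^sup>2"
      using assms(4,5) by (intro power_mono) auto
    then have "lmin0 * (c * norm x)\<^sup>2 \<le> lmin0 * (norm (Q x))\<^sup>2"
      using assms(9) by simp
    also have "\<dots> \<le> a0 x x"
      unfolding a0_def using assms(13) by blast
    finally show ?thesis unfolding \<alpha>_def by (simp add: power_mult_distrib mult_ac)
  qed
  have a0_nonneg: "0 \<le> a0 x x" for x
    using coer[of x] \<alpha> by (meson order_trans zero_le_mult_iff zero_le_power2 less_imp_le)
  have a_nonneg: "0 \<le> a x x" for x
    using cb(1)[of x] a0_nonneg[of x] c1 by (meson order_trans zero_le_mult_iff less_imp_le)
  have a0_eq: "x = y" if "\<And>w. a0 x w = a0 y w" for x y
  proof -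
    have "a0 (x - y) (x - y) = 0" using that by (simp add: a0.diff_left)
    then have "\<alpha> * (norm (x - y))\<^sup>2 \<le> 0" using coer[of "x - y"] by simp
    then show ?thesis using \<alpha> by (simp add: mult_le_0_iff)
  qed
  have "c\<^sub>1\<^sup>2 \<le> c\<^sub>2\<^sup>2" using c1 c12 by (intro power_mono) auto
  then have q2: "q\<^sup>2 = 1 - c\<^sub>1\<^sup>2 / c\<^sub>2\<^sup>2" and q0: "0 \<le> q" and q1: "q < 1"
    unfolding assms(19) using c1 c12 by (simp_all add: divide_le_eq)
  \<comment> \<open>The equation for \<open>u\<close> replaces \<open>j f w\<close> by
    \<open>a u w\<close>, so the residual becomes \<open>a\<close> applied to the error; the index
    is shifted to start at 0.\<close>
  have iter: "iterates A A\<^sub>0 Q (j f) \<rho> u\<^sub>0 us \<longleftrightarrow>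
      us 0 = u\<^sub>0 \<and> (\<forall>k w. a0 (us (Suc k)) w = a0 (us k) w - \<rho> * a (us k - u) w)" for us
  proof -
    have "iterates A A\<^sub>0 Q (j f) \<rho> u\<^sub>0 us \<longleftrightarrow> us 0 = u\<^sub>0 \<and>
       (\<forall>k\<ge>1. \<forall>w. a0 (us k) w = a0 (us (k - 1)) w - \<rho> * a (us (k - 1) - u) w)"
      using assms(17) unfolding iterates_def a0_def[symmetric] a_def[symmetric] by (simp add: a.diff_left)
    also have "(\<forall>k\<ge>1. \<forall>w. a0 (us k) w = a0 (us (k - 1)) w - \<rho> * a (us (k - 1) - u) w) \<longleftrightarrow>
        (\<forall>k w. a0 (us (Suc k)) w = a0 (us k) w - \<rho> * a (us k - u) w)"
      by (metis One_nat_def Suc_le_D diff_Suc_1 le_add1 plus_1_eq_Suc)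
    finally show ?thesis .
  qed
  \<comment> \<open>For a fixed current iterate \<open>x\<close> the right-hand side is a bounded
    functional of \<open>w\<close>. The resulting map \<open>S\<close> performs one step, and since
    \<open>a0_eq\<close> makes that step unique, the iterates are exactly the orbit of
    \<open>u\<^sub>0\<close> under \<open>S\<close>.\<close>
  have "\<exists>v. \<forall>w. a0 v w = a0 x w - \<rho> * a (x - u) w" for x
    by (rule symmetric_Lax_Milgram[OF bil(2) sym(2) \<alpha> coer])
      (intro bounded_linear_sub bounded_linear_const_mult a.bounded_linear_right a0.bounded_linear_right)
  then obtain S where S: "\<And>x w. a0 (S x) w = a0 x w - \<rho> * a (x - u) w"
    by metis
  have iter_S: "iterates A A\<^sub>0 Q (j f) \<rho> u\<^sub>0 us \<longleftrightarrow> us = (\<lambda>k. (S ^^ k) u\<^sub>0)" for us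
  proof
    assume "iterates A A\<^sub>0 Q (j f) \<rho> u\<^sub>0 us"
    then have "us 0 = u\<^sub>0" and "\<And>k. us (Suc k) = S (us k)"
      unfolding iter using S by (auto intro: a0_eq)
    then have "us k = (S ^^ k) u\<^sub>0" for k by (induction k) auto
    then show "us = (\<lambda>k. (S ^^ k) u\<^sub>0)" by blast
  next
    assume "us = (\<lambda>k. (S ^^ k) u\<^sub>0)"
    then show "iterates A A\<^sub>0 Q (j f) \<rho> u\<^sub>0 us" unfolding iter using S by simp
  qed
  have en: "energy_norm A\<^sub>0 Q x = sqrt (a0 x x)" for x
    unfolding energy_norm_def a0_def ..
  have contr: "energy_norm A\<^sub>0 Q (S x - u) \<le> q * energy_norm A\<^sub>0 Q (x - u)" for x
  proof -
    have "a0 (S x - u) (S x - u) \<le> q\<^sup>2 * a0 (x - u) (x - u)"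
      unfolding q2
      by (rule one_step_contraction[OF bil sym a_nonneg a0_nonneg c1 c12 cb])
        (simp add: a0.diff_left S assms(18))
    then have "sqrt (a0 (S x - u) (S x - u)) \<le> sqrt (q\<^sup>2 * a0 (x - u) (x - u))"
      by simp
    then show ?thesis unfolding en using q0 by (simp add: real_sqrt_mult)
  qed
  have rate: "energy_norm A\<^sub>0 Q ((S ^^ k) u\<^sub>0 - u) \<le> q ^ k * energy_norm A\<^sub>0 Q (u\<^sub>0 - u)" for k
  proof (induction k)
    case (Suc k)
    then show ?case
      using contr[of "(S ^^ k) u\<^sub>0"] mult_left_mono[OF Suc q0] by (simp add: mult.assoc)
  qed simp
  \<comment> \<open>By coercivity the norm of the error is at most its energy norm divided by
    \<open>sqrt \<alpha>\<close>, and the latter decays geometrically because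
    \<open>q < 1\<close>.\<close>
  have "(\<lambda>k. (S ^^ k) u\<^sub>0) \<longlonglongrightarrow> u"
  proof (rule Lim_transform_bound[THEN LIM_zero_cancel])
    show "\<forall>\<^sub>F k in sequentially. norm ((S ^^ k) u\<^sub>0 - u)
        \<le> norm (q ^ k * energy_norm A\<^sub>0 Q (u\<^sub>0 - u) / sqrt \<alpha>)"
    proof (intro always_eventually allI)
      fix k
      let ?e = "(S ^^ k) u\<^sub>0 - u"
      have "sqrt \<alpha> * norm ?e = sqrt (\<alpha> * (norm ?e)\<^sup>2)"
        by (simp add: real_sqrt_mult)
      also have "\<dots> \<le> energy_norm A\<^sub>0 Q ?e"
        unfolding en using coer by simp
      also note rate
      finally have "norm ?e \<le> q ^ k * energy_norm A\<^sub>0 Q (u\<^sub>0 - u) / sqrt \<alpha>"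
        using \<alpha> by (simp add: field_simps)
      then show "norm ?e \<le> norm (q ^ k * energy_norm A\<^sub>0 Q (u\<^sub>0 - u) / sqrt \<alpha>)"
        unfolding real_norm_def by (rule order_trans[OF _ abs_ge_self])
    qed
    show "(\<lambda>k. q ^ k * energy_norm A\<^sub>0 Q (u\<^sub>0 - u) / sqrt \<alpha>) \<longlonglongrightarrow> 0"
      using q0 q1 by (intro tendsto_divide_zero tendsto_mult_left_zero LIMSEQ_power_zero) auto
  qed
  then show ?thesis
    unfolding iter_S using q0 q1 rate by blast
qed

end
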